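(* There exists a Borel reduction from $E_0$ to the isomorphism relation on countable vertex-transitive tournaments. That is, there is a Borel function $f$ from $2^\omega$ into the space of binary relations on $\mathbb{N}$ such that each $f(x)$ is a vertex-transitive tournament and $x\mathrel{E_0}y$ if and only if $f(x)\cong f(y)$.
   Context: $E_0$ is the equivalence relation on $2^\omega$ given by $x\mathrel{E_0}y$ iff $x(n)=y(n)$ for all but finitely many $n$. A tournament is a directed graph in which for every pair of distinct vertices $x,y$ exactly one of $x\to y$, $y\to x$ holds (and there are no loops). It is vertex-transitive if its automorphism group acts transitively on its vertices. *)

theory Defs
  imports "HOL-Analysis.Analysis"
begin

definition E0 :: "(nat \<Rightarrow> bool) \<Rightarrow> (nat \<Rightarrow> bool) \<Rightarrow> bool" where
  "E0 x y \<longleftrightarrow> finite {n. x n \<noteq> y n}"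

definition tournament :: "('a \<Rightarrow> 'a \<Rightarrow> bool) \<Rightarrow> bool" where
  "tournament R \<longleftrightarrow>
     (\<forall>u. \<not> R u u) \<and> (\<forall>u v. u \<noteq> v \<longrightarrow> (R u v \<or> R v u) \<and> \<not> (R u v \<and> R v u))"

definition rel_isomorphism ::
    "('a \<Rightarrow> 'a \<Rightarrow> bool) \<Rightarrow> ('b \<Rightarrow> 'b \<Rightarrow> bool) \<Rightarrow> ('a \<Rightarrow> 'b) \<Rightarrow> bool" where
  "rel_isomorphism R S h \<longleftrightarrow> bij h \<and> (\<forall>u v. R u v \<longleftrightarrow> S (h u) (h v))"

definition rel_isomorphic ::
    "('a \<Rightarrow> 'a \<Rightarrow> bool) \<Rightarrow> ('b \<Rightarrow> 'b \<Rightarrow> bool) \<Rightarrow> bool" where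
  "rel_isomorphic R S \<longleftrightarrow> (\<exists>h. rel_isomorphism R S h)"

definition automorphisms :: "('a \<Rightarrow> 'a \<Rightarrow> bool) \<Rightarrow> ('a \<Rightarrow> 'a) set" where
  "automorphisms R = {h. rel_isomorphism R R h}"

definition vertex_transitive :: "('a \<Rightarrow> 'a \<Rightarrow> bool) \<Rightarrow> bool" where
  "vertex_transitive R \<longleftrightarrow> (\<forall>u v. \<exists>h\<in>automorphisms R. h u = v)"

text \<open>
  The space \<open>2\<^sup>\<omega>\<close> is the type \<^typ>\<open>nat \<Rightarrow> bool\<close>, and the space of binary relations on
  the natural numbers is the type \<^typ>\<open>nat \<Rightarrow> nat \<Rightarrow> bool\<close>. In both cases \<^const>\<open>borel\<close>
  refers to the product topology (the library's topology on function types) over the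
  discrete type \<^typ>\<open>bool\<close>; for relations this iterated product is the usual
  topology of \<open>2\<close> to the power \<open>\<nat> \<times> \<nat>\<close>.
\<close>

end

theory Submission
  imports Defs "HOL-Library.Poly_Mapping"
begin

text \<open>
  To a two-sided sequence \<open>s\<close> of bits attach the lexicographic product, over the levels
  \<open>i \<in> \<int>\<close>, of circulant tournaments on \<open>\<int>/7\<close>: the cyclic one (connection set \<open>{1, 2, 3}\<close>)
  where \<open>s i\<close> holds and the Paley one (connection set \<open>{1, 2, 4}\<close>) elsewhere. Vertices are the
  finitely supported functions, and an arc is decided at the highest level where its endpoints
  differ. This is a Cayley tournament. All three arcs of a 3-cycle live at the same level, and
  any two arcs at a vertex of the same level are linked by a chain of 3-cycles, so isomorphisms
  respect levels and their order; the type of a level is then visible from the number of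
  3-cycles through an arc. Hence two such tournaments are isomorphic iff the bit sequences agree
  up to a shift.

  It remains to reduce \<open>E\<^sub>0\<close> to shift equivalence. Read \<open>x\<close> as the 3-adic integer
  \<open>X = \<Sum>i. x i * 3 ^ i\<close> and let the \<open>n\<close>-th bit be the parity of the 3-adic valuation of \<open>n + X\<close>.
  This sequence determines \<open>X\<close>, so the sequences of \<open>x\<close> and \<open>y\<close> agree up to a shift iff
  \<open>X - Y\<close> is an integer; by uniqueness of balanced ternary expansions this means that \<open>x\<close> and
  \<open>y\<close> differ at finitely many places only.
\<close>

section \<open>Two circulant tournaments on seven vertices\<close>

definition conn :: "bool \<Rightarrow> 7 set" where
  "conn c = (if c then {1, 2, 3} else {1, 2, 4})"

lemma UNIV_7: "(UNIV :: 7 set) = {0, 1, 2, 3, 4, 5, 6}"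
  by (rule sym, rule card_subset_eq) simp_all

lemma all_7: "(\<forall>d::7. Q d) \<longleftrightarrow> Q 0 \<and> Q 1 \<and> Q 2 \<and> Q 3 \<and> Q 4 \<and> Q 5 \<and> Q 6"
  using UNIV_7 by (metis UNIV_I insert_iff empty_iff)

lemma ex_7: "(\<exists>d::7. Q d) \<longleftrightarrow> Q 0 \<or> Q 1 \<or> Q 2 \<or> Q 3 \<or> Q 4 \<or> Q 5 \<or> Q 6"
  using all_7[of "\<lambda>d. \<not> Q d"] by blast

lemma zero_notin_conn: "0 \<notin> conn c"
  by (simp add: conn_def)

lemma one_in_conn: "1 \<in> conn c"
  by (simp add: conn_def)

lemma uminus_in_conn_iff:
  assumes "d \<noteq> 0"
  shows "- d \<in> conn c \<longleftrightarrow> d \<notin> conn c"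
proof -
  have "\<forall>d. d \<noteq> 0 \<longrightarrow> (- d \<in> conn c \<longleftrightarrow> d \<notin> conn c)"
    unfolding all_7 by (simp add: conn_def)
  then show ?thesis
    using assms by blast
qed

text \<open>In the cyclic case \<open>q = 4\<close> serves all pairs; in the Paley case two distinct
  arcs leaving 0 share exactly one \<open>q\<close>. Thus any two arcs leaving a vertex are closed
  to 3-cycles by a common third vertex.\<close>

lemma conn_common_out:
  assumes "p \<in> conn c" "p' \<in> conn c"
  shows "\<exists>q. q - p \<in> conn c \<and> q - p' \<in> conn c \<and> - q \<in> conn c"
  using assms by (auto simp: conn_def ex_7 split: if_splits)

lemma conn_common_in:
  assumes "- p \<in> conn c" "- p' \<in> conn c"
  shows "\<exists>q. q \<in> conn c \<and> p - q \<in> conn c \<and> p' - q \<in> conn c"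
proof -
  obtain q where "q - (- p) \<in> conn c" "q - (- p') \<in> conn c" "- q \<in> conn c"
    using conn_common_out[OF assms] by blast
  then show ?thesis
    by (intro exI[of _ "- q"]) (simp add: add.commute)
qed

text \<open>The arc from 0 to 1 lies in only one 3-cycle of the cyclic tournament, whereas every
  Paley arc lies in two. This separates the two types.\<close>

lemma conn_True_cycle_unique:
  assumes "q - 1 \<in> conn True" "- q \<in> conn True"
  shows "q = 4"
proof -
  have "\<forall>q. q - 1 \<in> conn True \<and> - q \<in> conn True \<longrightarrow> q = 4"
    by (simp add: conn_def all_7)
  then show ?thesis
    using assms by blast
qed

lemma conn_False_two_cycles:
  assumes "p \<in> conn False"
  shows "\<exists>q q'. q \<noteq> q' \<and> q - p \<in> conn False \<and> - q \<in> conn False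
    \<and> q' - p \<in> conn False \<and> - q' \<in> conn False"
  using assms by (auto simp: conn_def ex_7)

section \<open>Lexicographic products of circulant tournaments\<close>

type_synonym vert = "int \<Rightarrow>\<^sub>0 7"

text \<open>For \<open>u \<noteq> v\<close>, \<open>deg (v - u)\<close> is the level that decides
  the arc between them; \<open>deg 0\<close> is the unspecified \<open>Max {}\<close>.\<close>

definition deg :: "vert \<Rightarrow> int" where
  "deg g = Max (Poly_Mapping.keys g)"

lemma deg_eqI:
  assumes "Poly_Mapping.lookup g i \<noteq> 0" "\<And>k. i < k \<Longrightarrow> Poly_Mapping.lookup g k = 0"
  shows "deg g = i"
  unfolding deg_def using assms
  by (intro Max_eqI) (auto simp: in_keys_iff not_less[symmetric])

lemma lookup_deg: "g \<noteq> 0 \<Longrightarrow> Poly_Mapping.lookup g (deg g) \<noteq> 0"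
  unfolding deg_def by (metis Max_in finite_keys in_keys_iff keys_eq_empty)

lemma lookup_above_deg: "deg g < k \<Longrightarrow> Poly_Mapping.lookup g k = 0"
  unfolding deg_def by (metis Max_ge finite_keys in_keys_iff not_less)

lemma deg_single: "q \<noteq> 0 \<Longrightarrow> deg (Poly_Mapping.single i q) = i"
  by (rule deg_eqI) (simp_all add: lookup_single)

lemma deg_uminus: "deg (- g) = deg g"
  unfolding deg_def by (rule arg_cong[of _ _ Max]) (auto simp: in_keys_iff)

lemma deg_minus_commute: "deg (g - g') = deg (g' - g)"
  using deg_uminus[of "g - g'"] by simp

definition pos :: "(int \<Rightarrow> bool) \<Rightarrow> vert set" where
  "pos s = {g. g \<noteq> 0 \<and> Poly_Mapping.lookup g (deg g) \<in> conn (s (deg g))}"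

lemma pos_deg_eqI:
  assumes "Poly_Mapping.lookup g i \<in> conn (s i)"
    and "\<And>k. i < k \<Longrightarrow> Poly_Mapping.lookup g k = 0"
  shows "g \<in> pos s \<and> deg g = i"
proof -
  have "Poly_Mapping.lookup g i \<noteq> 0"
    using assms(1) zero_notin_conn by metis
  then show ?thesis
    using deg_eqI[of g i] assms by (auto simp: pos_def)
qed

lemma uminus_in_pos_iff: "g \<noteq> 0 \<Longrightarrow> - g \<in> pos s \<longleftrightarrow> g \<notin> pos s"
  using lookup_deg[of g] by (simp add: pos_def deg_uminus uminus_in_conn_iff)

lemma zero_notin_pos: "0 \<notin> pos s"
  by (simp add: pos_def)

text \<open>If \<open>deg p < deg q\<close>, then \<open>p + q\<close> has the leading term of
  \<open>q\<close>, so it lies in \<open>pos s\<close> and its negative \<open>r\<close> cannot.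
  Rotating the summands makes all three degrees equal.\<close>

lemma pos_sum_zero_deg_le:
  assumes "p \<in> pos s" "q \<in> pos s" "r \<in> pos s" "p + q + r = 0"
  shows "deg q \<le> deg p"
proof (rule ccontr)
  assume "\<not> deg q \<le> deg p"
  then have less: "deg p < deg q"
    by simp
  have "p + q \<in> pos s"
    using pos_deg_eqI[of "p + q" "deg q" s] assms(2) less
    by (auto simp: lookup_add lookup_above_deg pos_def)
  moreover have "r = - (p + q)"
    using assms(4) by (metis eq_neg_iff_add_eq_0 add.commute)
  ultimately show False
    using assms(3) uminus_in_pos_iff[of "p + q" s] zero_notin_pos by metis
qed

lemma pos_sum_zero_deg_eq:
  assumes "p \<in> pos s" "q \<in> pos s" "r \<in> pos s" "p + q + r = 0"
  shows "deg p = deg q" "deg q = deg r"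
proof -
  have "deg q \<le> deg p" "deg r \<le> deg q" "deg p \<le> deg r"
    using pos_sum_zero_deg_le[of p s q r] pos_sum_zero_deg_le[of q s r p]
      pos_sum_zero_deg_le[of r s p q] assms by (simp_all add: ac_simps)
  then show "deg p = deg q" "deg q = deg r"
    by simp_all
qed

definition lex_tour :: "(int \<Rightarrow> bool) \<Rightarrow> vert \<Rightarrow> vert \<Rightarrow> bool" where
  "lex_tour s u v \<longleftrightarrow> v - u \<in> pos s"

lemma tournament_lex_tour: "tournament (lex_tour s)"
proof -
  have "v - u \<in> pos s \<longleftrightarrow> u - v \<notin> pos s" if "u \<noteq> v" for u v
    using uminus_in_pos_iff[of "u - v" s] that by simp
  then show ?thesis
    unfolding tournament_def lex_tour_def using zero_notin_pos[of s] by (metis diff_self)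
qed

lemma lex_tour_translation: "rel_isomorphism (lex_tour s) (lex_tour s) (\<lambda>g. g + w)"
  unfolding rel_isomorphism_def lex_tour_def
  by (auto intro!: bij_betw_byWitness[where f' = "\<lambda>g. g - w"])

lemma vertex_transitive_lex_tour: "vertex_transitive (lex_tour s)"
  unfolding vertex_transitive_def automorphisms_def
proof (intro allI)
  fix u v
  show "\<exists>h\<in>{h. rel_isomorphism (lex_tour s) (lex_tour s) h}. h u = v"
    using lex_tour_translation[of s "v - u"] by (intro bexI[of _ "\<lambda>g. g + (v - u)"]) auto
qed

section \<open>3-cycles and the levels of their arcs\<close>

definition cycle3 :: "(int \<Rightarrow> bool) \<Rightarrow> vert \<Rightarrow> vert \<Rightarrow> vert \<Rightarrow> bool" where
  "cycle3 s a b e \<longleftrightarrow> lex_tour s a b \<and> lex_tour s b e \<and> lex_tour s e a"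

lemma cycle3_deg:
  assumes "cycle3 s a b e"
  shows "deg (e - a) = deg (b - a)"
  using pos_sum_zero_deg_eq[of "b - a" s "e - b" "a - e"] assms deg_minus_commute[of e a]
  by (simp add: cycle3_def lex_tour_def)

lemma common_cycle3_out:
  assumes "lex_tour s a b" "lex_tour s a c" "deg (b - a) = deg (c - a)"
  shows "\<exists>e. cycle3 s a b e \<and> cycle3 s a c e"
proof -
  define i where "i = deg (b - a)"
  \<comment> \<open>The common third vertex will be \<open>a + Poly_Mapping.single i q\<close>; only
    the coefficients at level \<open>i\<close> matter.\<close>
  obtain q where q: "q - Poly_Mapping.lookup (b - a) i \<in> conn (s i)"
    "q - Poly_Mapping.lookup (c - a) i \<in> conn (s i)" "- q \<in> conn (s i)"
    using conn_common_out assms unfolding lex_tour_def pos_def i_def by fastforce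
  have "cycle3 s a d (a + Poly_Mapping.single i q)"
    if "lex_tour s a d" "deg (d - a) = i" "q - Poly_Mapping.lookup (d - a) i \<in> conn (s i)" for d
  proof -
    have "Poly_Mapping.single i q - (d - a) \<in> pos s"
      using pos_deg_eqI[of "Poly_Mapping.single i q - (d - a)" i s] that
        lookup_above_deg[of "d - a"] by (simp add: lookup_minus lookup_single)
    moreover have "- Poly_Mapping.single i q \<in> pos s"
      using pos_deg_eqI[of "- Poly_Mapping.single i q" i s] q(3) by (simp add: lookup_single)
    ultimately show ?thesis
      using that(1) by (simp add: cycle3_def lex_tour_def algebra_simps)
  qed
  then show ?thesis
    using assms q i_def by metis
qed

lemma common_cycle3_in:
  assumes "lex_tour s b a" "lex_tour s c a" "deg (b - a) = deg (c - a)"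
  shows "\<exists>e. cycle3 s a e b \<and> cycle3 s a e c"
proof -
  define i where "i = deg (b - a)"
  have "- Poly_Mapping.lookup (d - a) i \<in> conn (s i)"
    if "lex_tour s d a" "deg (d - a) = i" for d
    using that deg_minus_commute[of d a]
    by (auto simp: lex_tour_def pos_def lookup_minus)
  then obtain q where q: "q \<in> conn (s i)" "Poly_Mapping.lookup (b - a) i - q \<in> conn (s i)"
    "Poly_Mapping.lookup (c - a) i - q \<in> conn (s i)"
    using conn_common_in assms unfolding i_def by metis
  have "cycle3 s a (a + Poly_Mapping.single i q) d"
    if "lex_tour s d a" "deg (d - a) = i" "Poly_Mapping.lookup (d - a) i - q \<in> conn (s i)" for d
  proof -
    have "(d - a) - Poly_Mapping.single i q \<in> pos s"
      using pos_deg_eqI[of "(d - a) - Poly_Mapping.single i q" i s] that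
        lookup_above_deg[of "d - a"] by (simp add: lookup_minus lookup_single)
    moreover have "Poly_Mapping.single i q \<in> pos s"
      using pos_deg_eqI[of "Poly_Mapping.single i q" i s] q(1) by (simp add: lookup_single)
    ultimately show ?thesis
      using that(1) by (simp add: cycle3_def lex_tour_def algebra_simps)
  qed
  then show ?thesis
    using assms q i_def by metis
qed

section \<open>Isomorphisms preserve levels\<close>

lemma rel_isomorphism_cycle3:
  assumes "rel_isomorphism (lex_tour s) (lex_tour t) h"
  shows "cycle3 s a b e \<longleftrightarrow> cycle3 t (h a) (h b) (h e)"
  using assms by (auto simp: rel_isomorphism_def cycle3_def)

lemma rel_isomorphism_inv:
  assumes "rel_isomorphism R S h"
  shows "rel_isomorphism S R (inv h)"
  using assms unfolding rel_isomorphism_def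
  by (metis bij_imp_bij_inv bij_is_surj surj_f_inv_f)

lemma rel_isomorphism_comp:
  assumes "rel_isomorphism R S h" "rel_isomorphism S T k"
  shows "rel_isomorphism R T (k \<circ> h)"
  using assms by (auto simp: rel_isomorphism_def intro: bij_comp)

text \<open>Arcs at \<open>a\<close> with the same level and direction share a third vertex
  \<open>e\<close>. Since \<open>h\<close> preserves 3-cycles, both images have the level of the
  pair \<open>h e\<close>, \<open>h a\<close>.\<close>

lemma rel_isomorphism_deg_eq:
  assumes iso: "rel_isomorphism (lex_tour s) (lex_tour t) h"
    and ne: "b \<noteq> a" "c \<noteq> a" and eq: "deg (b - a) = deg (c - a)"
  shows "deg (h b - h a) = deg (h c - h a)"
proof -
  note cyc = rel_isomorphism_cycle3[OF iso]
  have total: "lex_tour s d a \<or> lex_tour s a d" if "d \<noteq> a" for d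
    using tournament_lex_tour[of s] that unfolding tournament_def by metis
  have out: "deg (h b - h a) = deg (h c - h a)"
    if "lex_tour s a b" "lex_tour s a c" "deg (b - a) = deg (c - a)" for b c
    using common_cycle3_out[OF that] cyc cycle3_deg by metis
  have into: "deg (h b - h a) = deg (h c - h a)"
    if "lex_tour s b a" "lex_tour s c a" "deg (b - a) = deg (c - a)" for b c
    using common_cycle3_in[OF that] cyc cycle3_deg by metis
  \<comment> \<open>The outgoing arc is traded for the incoming arc of a 3-cycle through it, which
    has the same level.\<close>
  have mixed: "deg (h b - h a) = deg (h c - h a)"
    if bc: "lex_tour s a b" "lex_tour s c a" "deg (b - a) = deg (c - a)" for b c
  proof -
    obtain e where e: "cycle3 s a b e"
      using common_cycle3_out[OF bc(1) bc(1) refl] by blast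
    then have "deg (h e - h a) = deg (h b - h a)"
      using cyc cycle3_deg by metis
    moreover have "deg (h e - h a) = deg (h c - h a)"
      using e bc cycle3_deg by (intro into) (auto simp: cycle3_def)
    ultimately show ?thesis
      by simp
  qed
  show ?thesis
    using total[OF ne(1)] total[OF ne(2)] out into mixed[of b c] mixed[of c b] eq by metis
qed

text \<open>A plain count of 3-cycles through an arc is infinite, as the third vertex may vary at
  lower levels. So third vertices are counted up to differences of lower level. The converse comes
  from the inverse isomorphism.\<close>

lemma rel_isomorphism_level_type:
  assumes iso: "rel_isomorphism (lex_tour s) (lex_tour t) h" and h0: "h 0 = 0"
    and g: "g \<noteq> 0" and type: "s (deg g)"
  shows "t (deg (h g))"
proof (rule ccontr)
  assume neg: "\<not> t (deg (h g))"
  have bij: "bij h"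
    using iso by (simp add: rel_isomorphism_def)
  define i where "i = deg g"
  define j where "j = deg (h g)"
  \<comment> \<open>Difference 1 is the cyclic arc whose third vertices all have coefficient 4 at
    level \<open>i\<close>.\<close>
  define b :: vert where "b = Poly_Mapping.single i 1"
  have b: "b \<noteq> 0" "deg b = i" "lex_tour s 0 b"
    using pos_deg_eqI[of b i s] one_in_conn zero_notin_pos[of s]
    by (auto simp: b_def lookup_single lex_tour_def)
  have "deg (h b - h 0) = deg (h g - h 0)"
    using rel_isomorphism_deg_eq[OF iso b(1) g] b by (simp add: i_def)
  then have hb: "deg (h b) = j"
    by (simp add: h0 j_def)
  have hb_tour: "lex_tour t 0 (h b)"
    using iso b(3) h0 unfolding rel_isomorphism_def by metis
  then have "Poly_Mapping.lookup (h b) j \<in> conn False"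
    using hb neg by (auto simp: lex_tour_def pos_def j_def)
  then obtain q q' where q: "q \<noteq> q'"
    "q - Poly_Mapping.lookup (h b) j \<in> conn False" "- q \<in> conn False"
    "q' - Poly_Mapping.lookup (h b) j \<in> conn False" "- q' \<in> conn False"
    using conn_False_two_cycles by blast
  have cyc: "cycle3 t 0 (h b) (Poly_Mapping.single j r)"
    if "r - Poly_Mapping.lookup (h b) j \<in> conn False" "- r \<in> conn False" for r
  proof -
    have "Poly_Mapping.single j r - h b \<in> pos t"
      using pos_deg_eqI[of "Poly_Mapping.single j r - h b" j t] that neg
        lookup_above_deg[of "h b"] hb by (simp add: lookup_minus lookup_single j_def)
    moreover have "- Poly_Mapping.single j r \<in> pos t"
      using pos_deg_eqI[of "- Poly_Mapping.single j r" j t] that neg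
      by (simp add: lookup_single j_def)
    ultimately show ?thesis
      using hb_tour by (simp add: cycle3_def lex_tour_def)
  qed
  define w where "w = inv h (Poly_Mapping.single j q)"
  define w' where "w' = inv h (Poly_Mapping.single j q')"
  have hw: "h w = Poly_Mapping.single j q" "h w' = Poly_Mapping.single j q'"
    using bij by (simp_all add: w_def w'_def bij_is_surj surj_f_inv_f)
  have cw: "cycle3 s 0 b w" "cycle3 s 0 b w'"
    using cyc[OF q(2,3)] cyc[OF q(4,5)] rel_isomorphism_cycle3[OF iso] hw h0 by metis+
  have four: "deg v = i \<and> Poly_Mapping.lookup v i = 4" if "cycle3 s 0 b v" for v
  proof -
    have pos: "b \<in> pos s" "v - b \<in> pos s" "- v \<in> pos s"
      using that by (auto simp: cycle3_def lex_tour_def)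
    have "deg (v - b) = i" "deg (- v) = i"
      using pos_sum_zero_deg_eq[OF pos] b(2) by simp_all
    then have "Poly_Mapping.lookup v i - 1 \<in> conn True" "- Poly_Mapping.lookup v i \<in> conn True"
      using pos type by (auto simp: pos_def i_def b_def lookup_minus)
    then show ?thesis
      using conn_True_cycle_unique \<open>deg (- v) = i\<close> by (simp add: deg_uminus)
  qed
  have "w' \<noteq> w"
    using hw q(1) by (metis lookup_single_eq)
  moreover have "w \<noteq> 0"
    using cw(1) zero_notin_pos[of s] by (auto simp: cycle3_def lex_tour_def)
  moreover have "deg (h w' - h w) = deg (h 0 - h w)"
  proof -
    have "q \<noteq> 0"
      using q(3) zero_notin_conn by fastforce
    have "deg (h w' - h w) = j"
      using q(1) by (intro deg_eqI) (simp_all add: hw lookup_minus lookup_single)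
    then show ?thesis
      using deg_single[OF \<open>q \<noteq> 0\<close>, of j] by (simp add: hw h0 deg_uminus)
  qed
  \<comment> \<open>Seen from \<open>h w\<close>, both \<open>h w'\<close> and \<open>h 0\<close>
    are at level \<open>j\<close>; the inverse isomorphism carries this back to
    \<open>w\<close>.\<close>
  ultimately have "deg (w' - w) = deg (0 - w)"
    using rel_isomorphism_deg_eq[OF rel_isomorphism_inv[OF iso], of "h w'" "h w" "h 0"]
      bij by (simp add: bij_is_inj inv_f_f inj_eq)
  then have "deg (w' - w) = i"
    using four[OF cw(1)] by (simp add: deg_uminus)
  moreover have "Poly_Mapping.lookup (w' - w) i = 0"
    using four[OF cw(1)] four[OF cw(2)] by (simp add: lookup_minus)
  ultimately show False
    using lookup_deg[of "w' - w"] \<open>w' \<noteq> w\<close> by simp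
qed

section \<open>Isomorphism is equivalent to a shift of levels\<close>

lemma strict_mono_surj_int:
  fixes \<phi> :: "int \<Rightarrow> int"
  assumes "strict_mono \<phi>" "surj \<phi>"
  shows "\<phi> i = i + \<phi> 0"
proof -
  have Suc: "\<phi> (i + 1) = \<phi> i + 1" for i
  proof -
    obtain j where j: "\<phi> j = \<phi> i + 1"
      using assms(2) by (metis surjD)
    then have "i < j"
      using strict_mono_less[OF assms(1), of i j] by simp
    then have "\<phi> (i + 1) \<le> \<phi> j"
      using strict_mono_less_eq[OF assms(1)] by simp
    moreover have "\<phi> i < \<phi> (i + 1)"
      using strict_mono_less[OF assms(1)] by simp
    ultimately show ?thesis
      using j by simp
  qed
  show ?thesis
  proof (induction i rule: int_induct[of _ 0])
    case (step1 i)
    then show ?case using Suc[of i] by simp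
  next
    case (step2 i)
    then show ?case using Suc[of "i - 1"] by simp
  qed simp
qed

lemma lex_tour_isomorphic_imp_shift:
  assumes "rel_isomorphic (lex_tour s) (lex_tour t)"
  shows "\<exists>k. \<forall>i. s i = t (i + k)"
proof -
  obtain h' where "rel_isomorphism (lex_tour s) (lex_tour t) h'"
    using assms by (auto simp: rel_isomorphic_def)
  \<comment> \<open>Translations are automorphisms, so the isomorphism may be normalised to fix
    0.\<close>
  from rel_isomorphism_comp[OF this lex_tour_translation[of t "- h' 0"]]
  obtain h where iso: "rel_isomorphism (lex_tour s) (lex_tour t) h" and h0: "h 0 = 0"
    by fastforce
  have bij: "bij h"
    using iso by (simp add: rel_isomorphism_def)
  note iso' = rel_isomorphism_inv[OF iso]
  have inv_h: "inv h (h g) = g" "h (inv h g) = g" for g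
    using bij by (simp_all add: bij_is_inj bij_is_surj surj_f_inv_f)
  have inv_h0: "inv h 0 = 0"
    using inv_h(1)[of 0] h0 by simp
  have h_ne: "h g \<noteq> h g'" if "g \<noteq> g'" for g g'
    using inv_h that by metis
  define e :: "int \<Rightarrow> vert" where "e i = Poly_Mapping.single i 1" for i
  have e: "e i \<noteq> 0" "deg (e i) = i" for i
    using deg_single[of 1 i] by (auto simp: e_def) (metis lookup_single_eq lookup_zero zero_neq_one)
  define \<phi> where "\<phi> i = deg (h (e i))" for i
  have deg_h: "deg (h g) = \<phi> (deg g)" if "g \<noteq> 0" for g
    using rel_isomorphism_deg_eq[OF iso that e(1)[of "deg g"]] e by (simp add: h0 \<phi>_def)
  have surj: "surj \<phi>"
  proof (rule surjI)
    fix j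
    have "inv h (e j) \<noteq> 0"
      using inv_h h0 e(1) by metis
    then show "\<phi> (deg (inv h (e j))) = j"
      using deg_h[of "inv h (e j)"] e(2) inv_h by simp
  qed
  have inj: "i = j" if "\<phi> i = \<phi> j" for i j
    using rel_isomorphism_deg_eq[OF iso' h_ne[OF e(1)[of i]] h_ne[OF e(1)[of j]]] that e
    by (simp add: h0 inv_h inv_h0 \<phi>_def)
  have mono: "strict_mono \<phi>"
  proof (rule strict_monoI, rule ccontr)
    fix i j :: int
    assume ij: "i < j" and "\<not> \<phi> i < \<phi> j"
    then have less: "\<phi> j < \<phi> i"
      using inj[of i j] by force
    \<comment> \<open>Seen from \<open>e j\<close>, both \<open>e i\<close> and 0 are at level
      \<open>j\<close>, so \<open>h (e i)\<close> is at level \<open>\<phi> j\<close> from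
      \<open>h (e j)\<close>. But if \<open>\<phi> j < \<phi> i\<close>, the leading term of
      \<open>h (e i)\<close> survives in the difference.\<close>
    have "deg (e i - e j) = j" "deg (0 - e j) = j"
      using ij e(2)[of j]
      by (auto intro!: deg_eqI simp: e_def lookup_minus lookup_single deg_uminus)
    then have "deg (h (e i) - h (e j)) = deg (h 0 - h (e j))"
      using rel_isomorphism_deg_eq[OF iso, of "e i" "e j" 0] e ij
      by (metis order_less_irrefl)
    then have "deg (h (e i) - h (e j)) = \<phi> j"
      by (simp add: h0 \<phi>_def deg_uminus)
    moreover have "deg (h (e i) - h (e j)) = \<phi> i"
    proof (rule deg_eqI)
      show "Poly_Mapping.lookup (h (e i) - h (e j)) (\<phi> i) \<noteq> 0"
        using less lookup_deg[of "h (e i)"] lookup_above_deg[of "h (e j)" "\<phi> i"] h_ne[OF e(1)[of i]]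
        by (simp add: lookup_minus h0 \<phi>_def)
      show "Poly_Mapping.lookup (h (e i) - h (e j)) k = 0" if "\<phi> i < k" for k
        using less that by (simp add: lookup_minus lookup_above_deg \<phi>_def)
    qed
    ultimately show False
      using less by simp
  qed
  have "s i = t (\<phi> i)" for i
  proof
    show "s i \<Longrightarrow> t (\<phi> i)"
      using rel_isomorphism_level_type[OF iso h0 e(1)[of i]] e by (simp add: \<phi>_def)
    show "t (\<phi> i) \<Longrightarrow> s i"
      using rel_isomorphism_level_type[OF iso' inv_h0, of "h (e i)"] h_ne[OF e(1)[of i]] h0 e inv_h
      by (simp add: \<phi>_def)
  qed
  then show ?thesis
    using strict_mono_surj_int[OF mono surj] by metis
qed

lemma shift_imp_lex_tour_isomorphic:
  assumes "\<And>i. s i = t (i + k)"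
  shows "rel_isomorphic (lex_tour s) (lex_tour t)"
proof -
  define S where "S l = (Poly_Mapping.map_key (\<lambda>i. i - l) :: vert \<Rightarrow> vert)" for l
  have lookup_S: "Poly_Mapping.lookup (S l g) i = Poly_Mapping.lookup g (i - l)" for l g i
    by (simp add: S_def map_key.rep_eq inj_on_def)
  have bij: "bij (S k)"
    by (rule bij_betw_byWitness[where f' = "S (- k)"])
      (auto intro!: poly_mapping_eqI simp: lookup_S)
  have S_pos: "S k g \<in> pos t" if "g \<in> pos s" for g
    using pos_deg_eqI[of "S k g" "deg g + k" t] that assms
    by (auto simp: lookup_S pos_def lookup_above_deg)
  have S_minus: "S k (g - g') = S k g - S k g'" for g g'
    by (auto intro!: poly_mapping_eqI simp: lookup_S lookup_minus)
  \<comment> \<open>One inclusion suffices: for nonzero \<open>g\<close> exactly one of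
    \<open>g\<close> and \<open>- g\<close> is positive, and \<open>S k\<close> commutes with
    negation.\<close>
  have "g \<in> pos s \<longleftrightarrow> S k g \<in> pos t" for g
  proof (cases "g = 0")
    case False
    have "S k (- g) = - S k g"
      by (auto intro!: poly_mapping_eqI simp: lookup_S)
    then show ?thesis
      using S_pos[of g] S_pos[of "- g"] uminus_in_pos_iff[OF False, of s]
        uminus_in_pos_iff[of "S k g" t] zero_notin_pos[of t] by (metis neg_equal_0_iff_equal)
  next
    case True
    have "S k 0 = 0"
      by (auto intro!: poly_mapping_eqI simp: lookup_S)
    then show ?thesis
      using True by (simp add: zero_notin_pos)
  qed
  then show ?thesis
    unfolding rel_isomorphic_def rel_isomorphism_def lex_tour_def
    using bij by (auto simp flip: S_minus)
qed

section \<open>The odometer coding\<close>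

definition ternary :: "(nat \<Rightarrow> bool) \<Rightarrow> nat \<Rightarrow> int" where
  "ternary x m = (\<Sum>i<m. of_bool (x i) * 3 ^ i)"

text \<open>
  The \<open>LEAST\<close> is one more than the 3-adic valuation of \<open>n + X\<close>; it is a junk value for the at most
  one \<open>n\<close> with \<open>n + X = 0\<close>, which the proof of \<open>toeplitz_shift_iff\<close> never has to evaluate.
\<close>

definition toeplitz :: "(nat \<Rightarrow> bool) \<Rightarrow> int \<Rightarrow> bool" where
  "toeplitz x n \<longleftrightarrow> even (LEAST m. \<not> 3 ^ m dvd n + ternary x m)"

lemma ternary_Suc: "ternary x (Suc m) = ternary x m + of_bool (x m) * 3 ^ m"
  unfolding ternary_def by (rule sum.lessThan_Suc)

lemma ternary_cong:
  assumes "j \<le> m"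
  shows "3 ^ j dvd ternary x m - ternary x j"
  using assms
proof (induction m rule: dec_induct)
  case (step m)
  have "(3::int) ^ j dvd of_bool (x m) * 3 ^ m"
    using step.hyps by (simp add: le_imp_power_dvd)
  then have "3 ^ j dvd (ternary x m - ternary x j) + of_bool (x m) * 3 ^ m"
    using step.IH by (rule dvd_add[rotated])
  then show ?case
    by (simp add: ternary_Suc algebra_simps)
qed simp

text \<open>The difference has digits -1, 0, 1 in base 3, hence absolute value at most
  \<open>(3 ^ m - 1) / 2\<close>. This is the source of uniqueness of balanced expansions.\<close>

lemma ternary_diff_bound: "2 * \<bar>ternary x m - ternary y m\<bar> < 3 ^ m"
proof (induction m)
  case (Suc m)
  define d where "d = ternary x m - ternary y m"
  define r :: int where "r = (of_bool (x m) - of_bool (y m)) * 3 ^ m"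
  have "\<bar>r\<bar> \<le> 3 ^ m"
    unfolding r_def by (cases "x m"; cases "y m") simp_all
  moreover have "2 * \<bar>d\<bar> < 3 ^ m"
    using Suc by (simp add: d_def)
  ultimately have "2 * \<bar>d + r\<bar> < 3 * 3 ^ m"
    by (smt (verit))
  moreover have "ternary x (Suc m) - ternary y (Suc m) = d + r"
    by (simp add: d_def r_def ternary_Suc algebra_simps)
  ultimately show ?case
    by simp
qed (simp add: ternary_def)

text \<open>The right-hand side says \<open>k = X - Y\<close> in the 3-adic integers, modulo each
  power of 3.\<close>

lemma toeplitz_shift_iff:
  "(\<forall>n. toeplitz x n = toeplitz y (n + k)) \<longleftrightarrow>
   (\<forall>m. 3 ^ m dvd k + ternary y m - ternary x m)"
proof
  assume dvd: "\<forall>m. 3 ^ m dvd k + ternary y m - ternary x m"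
  have "3 ^ m dvd n + ternary x m \<longleftrightarrow> 3 ^ m dvd n + k + ternary y m" for m n
    using dvd_add_right_iff[of "3 ^ m" "k + ternary y m - ternary x m" "n + ternary x m"] dvd
    by (simp add: algebra_simps)
  then show "\<forall>n. toeplitz x n = toeplitz y (n + k)"
    by (simp add: toeplitz_def)
next
  assume eq: "\<forall>n. toeplitz x n = toeplitz y (n + k)"
  show "\<forall>m. 3 ^ m dvd k + ternary y m - ternary x m"
  proof (rule ccontr)
    assume "\<not> ?thesis"
    then obtain m where m: "\<not> 3 ^ m dvd k + ternary y m - ternary x m"
      by blast
    define l where "l = (LEAST m. \<not> 3 ^ m dvd k + ternary y m - ternary x m)"
    have l: "\<not> 3 ^ l dvd k + ternary y l - ternary x l"
      unfolding l_def by (rule LeastI[of "\<lambda>m. \<not> 3 ^ m dvd k + ternary y m - ternary x m", OF m])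
    have l_least: "3 ^ j dvd k + ternary y j - ternary x j" if "j < l" for j
      using not_less_Least[OF that[unfolded l_def]] by blast
    \<comment> \<open>Choose \<open>n\<close> so that \<open>n + X\<close> has valuation exactly \<open>a\<close>; then the valuation of \<open>n + k + Y\<close> is
      that of \<open>k + Y - X\<close>, whatever the parity of \<open>a\<close>.\<close>
    have parity: "even (Suc a) \<longleftrightarrow> even l" if "l \<le> a" for a
    proof -
      \<comment> \<open>\<open>n + ternary x (Suc a)\<close> is exactly
        \<open>3 ^ a\<close>.\<close>
      define n where "n = 3 ^ a - ternary x (Suc a)"
      have x_dvd: "3 ^ j dvd n + ternary x j" if "j \<le> a" for j
      proof -
        have "(3::int) ^ j dvd 3 ^ a - (ternary x (Suc a) - ternary x j)"
          using that by (intro dvd_diff ternary_cong) (simp_all add: le_imp_power_dvd)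
        then show ?thesis
          by (simp add: n_def algebra_simps)
      qed
      have "\<not> (3::int) ^ Suc a dvd n + ternary x (Suc a)"
        by (simp add: n_def power_dvd_imp_le zdvd_not_zless)
      then have "(LEAST j. \<not> 3 ^ j dvd n + ternary x j) = Suc a"
        using x_dvd by (intro Least_equality) (auto simp: not_less_eq_eq[symmetric])
      moreover have "3 ^ j dvd n + k + ternary y j \<longleftrightarrow> 3 ^ j dvd k + ternary y j - ternary x j"
        if "j \<le> a" for j
        using dvd_add_right_iff[OF x_dvd[OF that], of "k + ternary y j - ternary x j"]
        by (simp add: algebra_simps)
      then have "(LEAST j. \<not> 3 ^ j dvd n + k + ternary y j) = l"
        using l l_least \<open>l \<le> a\<close> by (intro Least_equality) (auto simp: not_less[symmetric])
      ultimately show ?thesis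
        using spec[OF eq, of n] by (simp add: toeplitz_def)
    qed
    \<comment> \<open>From \<open>a = l\<close> to \<open>a = Suc l\<close> the parity of
      \<open>Suc a\<close> changes, while that of \<open>l\<close> is fixed.\<close>
    show False
      using parity[of l] parity[of "Suc l"] by simp
  qed
qed

lemma E0_iff_toeplitz_shift: "E0 x y \<longleftrightarrow> (\<exists>k. \<forall>n. toeplitz x n = toeplitz y (n + k))"
proof
  assume "E0 x y"
  then obtain M where "\<forall>i\<in>{i. x i \<noteq> y i}. i < M"
    unfolding E0_def finite_nat_set_iff_bounded by blast
  then have M: "x i = y i" if "M \<le> i" for i
    using that leD by blast
  \<comment> \<open>The digits of \<open>X - Y\<close> vanish from \<open>M\<close> on, so
    \<open>X - Y\<close> is this integer.\<close>
  define k where "k = ternary x M - ternary y M"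
  have "3 ^ m dvd k + ternary y m - ternary x m" for m
  proof (cases "m \<le> M")
    case True
    then have "3 ^ m dvd (ternary x M - ternary x m) - (ternary y M - ternary y m)"
      by (intro dvd_diff ternary_cong)
    then show ?thesis
      by (simp add: k_def algebra_simps)
  next
    case False
    then have "M \<le> m"
      by simp
    then have "k = ternary x m - ternary y m"
      by (induction m rule: dec_induct) (simp_all add: k_def ternary_Suc M)
    then show ?thesis
      by simp
  qed
  then show "\<exists>k. \<forall>n. toeplitz x n = toeplitz y (n + k)"
    using toeplitz_shift_iff by blast
next
  assume "\<exists>k. \<forall>n. toeplitz x n = toeplitz y (n + k)"
  then obtain k where k: "3 ^ m dvd k + ternary y m - ternary x m" for m
    using toeplitz_shift_iff by blast
  have eq: "ternary x m - ternary y m = k" if "nat (2 * \<bar>k\<bar>) \<le> m" for m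
  proof -
    \<comment> \<open>Both \<open>k\<close> and the ternary difference are below
      \<open>3 ^ m / 2\<close> in absolute value, so their difference, a multiple of
      \<open>3 ^ m\<close>, is 0.\<close>
    have "2 * \<bar>k\<bar> \<le> int m"
      using that by simp
    also have "int m < 3 ^ m"
      using of_nat_less_iff[of m "3 ^ m", where 'a = int] power_gt_expt[of 3 m] by simp
    finally have "\<bar>k + ternary y m - ternary x m\<bar> < 3 ^ m"
      using ternary_diff_bound[of x m y] by (smt (verit))
    moreover have "d = 0" if "\<bar>d\<bar> < p" "p dvd d" for d p :: int
      using that dvd_imp_le_int[of d p] by auto
    ultimately have "k + ternary y m - ternary x m = 0"
      using k[of m] by blast
    then show ?thesis
      by simp
  qed
  \<comment> \<open>The truncations at \<open>m\<close> and \<open>Suc m\<close> both differ by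
    \<open>k\<close>, which forces the digits at \<open>m\<close> to agree.\<close>
  have "m < nat (2 * \<bar>k\<bar>)" if "x m \<noteq> y m" for m
  proof (rule ccontr)
    assume "\<not> ?thesis"
    then have "ternary x m - ternary y m = k" "ternary x (Suc m) - ternary y (Suc m) = k"
      using eq[of m] eq[of "Suc m"] by simp_all
    then have "of_bool (x m) * 3 ^ m = (of_bool (y m) * 3 ^ m :: int)"
      unfolding ternary_Suc by linarith
    then show False
      using that by (cases "x m"; cases "y m") simp_all
  qed
  then have "{m. x m \<noteq> y m} \<subseteq> {..<nat (2 * \<bar>k\<bar>)}"
    by (simp add: subset_iff)
  then show "E0 x y"
    unfolding E0_def by (rule finite_subset) simp
qed

section \<open>Borel measurability of the coding\<close>

instance bool :: second_countable_topology
proof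
  show "\<exists>B :: bool set set. countable B \<and> open = generate_topology B"
    by (intro exI[of _ UNIV]) (auto simp: fun_eq_iff open_discrete intro: generate_topology.Basis)
qed

lemma borel_measurable_bool_iff:
  fixes f :: "'a \<Rightarrow> bool"
  shows "f \<in> borel_measurable M \<longleftrightarrow> f \<in> M \<rightarrow>\<^sub>M count_space UNIV"
  using measurable_cong_sets[of M M borel "count_space UNIV"] sets_borel_eq_count_space by blast

lemma measurable_toeplitz: "(\<lambda>x. toeplitz x n) \<in> borel \<rightarrow>\<^sub>M count_space UNIV"
proof -
  have [measurable]: "(\<lambda>x :: nat \<Rightarrow> bool. x i) \<in> borel \<rightarrow>\<^sub>M count_space UNIV" for i
    using measurable_product_coordinates[of i] borel_measurable_bool_iff by blast
  have [measurable]: "(\<lambda>x. ternary x m) \<in> borel \<rightarrow>\<^sub>M count_space UNIV" for m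
  proof (induction m)
    case (Suc m)
    have [measurable]: "(\<lambda>x. ternary x m) \<in> borel \<rightarrow>\<^sub>M count_space UNIV"
      by (rule Suc)
    have "(\<lambda>x. ternary x m + of_bool (x m) * 3 ^ m) \<in> borel \<rightarrow>\<^sub>M count_space UNIV"
      by measurable
    then show ?case
      by (simp only: ternary_Suc)
  qed (simp add: ternary_def)
  show ?thesis
    unfolding toeplitz_def by measurable
qed

section \<open>The reduction\<close>

lemma countable_vert: "countable (UNIV :: vert set)"
proof -
  \<comment> \<open>A finitely supported function is determined by its finite set of nonzero
    entries, and there are countably many such sets.\<close>
  define graph where "graph g = (\<lambda>k. (k, Poly_Mapping.lookup g k)) ` Poly_Mapping.keys g" for g :: vert
  have mem: "(k, q) \<in> graph g \<longleftrightarrow> Poly_Mapping.lookup g k = q \<and> q \<noteq> 0" for g k q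
    by (auto simp: graph_def in_keys_iff)
  have "inj graph"
  proof (rule injI, rule poly_mapping_eqI)
    fix g g' :: vert and k
    assume "graph g = graph g'"
    then show "Poly_Mapping.lookup g k = Poly_Mapping.lookup g' k"
      using mem by metis
  qed
  moreover have "countable (range graph)"
    by (rule countable_subset[OF _ countable_Collect_finite]) (auto simp: graph_def)
  ultimately show ?thesis
    by (simp add: countable_image_inj_eq)
qed

lemma infinite_vert: "infinite (UNIV :: vert set)"
proof -
  have "inj (\<lambda>i. Poly_Mapping.single i 1 :: vert)"
    by (rule injI) (metis deg_single zero_neq_one)
  then show ?thesis
    using infinite_UNIV_int finite_imageD finite_subset[OF subset_UNIV] by blast
qed

lemma rel_isomorphism_pullback:
  assumes "bij e"
  shows "rel_isomorphism (\<lambda>m n. R (e m) (e n)) R e"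
  using assms by (simp add: rel_isomorphism_def)

theorem theorem4p2:
  shows "\<exists>f :: (nat \<Rightarrow> bool) \<Rightarrow> (nat \<Rightarrow> nat \<Rightarrow> bool).
           f \<in> borel \<rightarrow>\<^sub>M borel \<and>
           (\<forall>x. tournament (f x) \<and> vertex_transitive (f x)) \<and>
           (\<forall>x y. E0 x y \<longleftrightarrow> rel_isomorphic (f x) (f y))"
proof -
  \<comment> \<open>One enumeration of the vertices serves all \<open>x\<close>, which keeps
    \<open>f\<close> Borel.\<close>
  obtain e :: "nat \<Rightarrow> vert" where bij: "bij e"
    using bij_betw_from_nat_into[OF countable_vert infinite_vert] by blast
  have inj: "e m = e n \<longleftrightarrow> m = n" for m n
    using bij by (simp add: bij_is_inj inj_eq)
  define f where "f = (\<lambda>x m n. lex_tour (toeplitz x) (e m) (e n))"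
  have pull: "rel_isomorphism (f x) (lex_tour (toeplitz x)) e" for x
    using rel_isomorphism_pullback[OF bij, of "lex_tour (toeplitz x)"] by (simp add: f_def)
  have "f \<in> borel \<rightarrow>\<^sub>M borel"
  proof (intro measurable_coordinatewise_then_product)
    fix m n
    \<comment> \<open>For fixed \<open>m\<close> and \<open>n\<close> the arc depends on
      \<open>x\<close> only through the bit at \<open>deg g\<close>.\<close>
    define g where "g = e n - e m"
    have "(\<lambda>x. g \<noteq> 0 \<and> Poly_Mapping.lookup g (deg g) \<in> conn (toeplitz x (deg g)))
        \<in> borel \<rightarrow>\<^sub>M count_space UNIV"
      by (rule measurable_compose[OF measurable_toeplitz]) simp
    then show "(\<lambda>x. f x m n) \<in> borel_measurable borel"
      unfolding borel_measurable_bool_iff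
      by (simp add: f_def lex_tour_def pos_def g_def)
  qed
  moreover have "tournament (f x)" for x
    using tournament_lex_tour[of "toeplitz x"] inj by (simp add: tournament_def f_def)
  moreover have "vertex_transitive (f x)" for x
    unfolding vertex_transitive_def
  proof (intro allI)
    fix m n
    obtain h where h: "rel_isomorphism (lex_tour (toeplitz x)) (lex_tour (toeplitz x)) h"
      and hm: "h (e m) = e n"
      using vertex_transitive_lex_tour[of "toeplitz x"]
      unfolding vertex_transitive_def automorphisms_def by blast
    have "rel_isomorphism (f x) (f x) (inv e \<circ> (h \<circ> e))"
      using pull h rel_isomorphism_comp rel_isomorphism_inv by metis
    moreover have "(inv e \<circ> (h \<circ> e)) m = n"
      using hm bij by (simp add: bij_is_inj)
    ultimately show "\<exists>h\<in>automorphisms (f x). h m = n"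
      unfolding automorphisms_def by blast
  qed
  moreover have "E0 x y \<longleftrightarrow> rel_isomorphic (f x) (f y)" for x y
  proof -
    have "rel_isomorphic (f x) (f y) \<longleftrightarrow>
        rel_isomorphic (lex_tour (toeplitz x)) (lex_tour (toeplitz y))"
      unfolding rel_isomorphic_def
      using pull rel_isomorphism_comp rel_isomorphism_inv by metis
    then show ?thesis
      using lex_tour_isomorphic_imp_shift shift_imp_lex_tour_isomorphic E0_iff_toeplitz_shift
      by metis
  qed
  ultimately show ?thesis
    by blast
qed

end
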